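(* For every monotonic-MAX GNN $\mathcal{N}$ and all pointed graphs $(G,v)$, $(G',v')$ of its dimension, if there is a homomorphism from $(G,v)$ to $(G',v')$ and $\mathcal{N}(G,v)=\mathsf{true}$, then $\mathcal{N}(G',v')=\mathsf{true}$.
   Context: Graphs are finite, undirected, simple, node-labelled $G=(V,E,\lambda)$ with $\lambda:V\to\{0,1\}^d$; a pointed graph is $(G,v)$. A homomorphism from $(G,v)$ to $(G',v')$, $G'=(V',E',\lambda')$, is $h:V\to V'$ with $h(v)=v'$ such that $\{u,w\}\in E$ implies $\{h(u),h(w)\}\in E'$ and every entry equal to $1$ in $\lambda(u)$ is $1$ in $\lambda'(h(u))$. A GNN of dimension $d$ with $L$ layers consists of layers $(\mathsf{agg}_\ell,\mathsf{comb}_\ell)$ ($\mathsf{agg}_\ell$ maps finite multisets of vectors to vectors, $\mathsf{comb}_\ell$ maps vectors to vectors, dimensions compatible, first input dimension $d$) and a classification function $\mathsf{cls}$ from vectors to $\{\mathsf{false},\mathsf{true}\}$. On $G$: $\lambda^{(0)}=\lambda$, $\lambda^{(\ell)}(v)=\mathsf{comb}_\ell(\lambda^{(\ell-1)}(v),\mathsf{agg}_\ell(\{\!\{\lambda^{(\ell-1)}(w):\{v,w\}\in E\}\!\}))$, $\mathcal{N}(G,v)=\mathsf{cls}(\lambda^{(L)}(v))$. Order: vectors componentwise; multisets $M\le M'$ iff there is an injection $f:M\to M'$ with $\mathbf{x}\le f(\mathbf{x})$; $\mathsf{false}\le\mathsf{true}$. A GNN is monotonic if all its aggregation, combination and classification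 functions are non-decreasing. A monotonic-MAX GNN is a monotonic GNN all of whose aggregation functions are MAX (componentwise maximum of the multiset). *)

theory Defs
  imports Complex_Main "HOL-Library.Multiset" "HOL-Library.FuncSet"
begin

record 'v lgraph =
  verts :: "'v set"
  edges :: "'v set set"
  label :: "'v \<Rightarrow> real list"

definition is_lgraph :: "nat \<Rightarrow> 'v lgraph \<Rightarrow> bool" where
  "is_lgraph d G \<longleftrightarrow>
     finite (verts G) \<and>
     (\<forall>e\<in>edges G. \<exists>u w. e = {u, w} \<and> u \<noteq> w \<and> u \<in> verts G \<and> w \<in> verts G) \<and>
     (\<forall>u\<in>verts G. length (label G u) = d \<and> set (label G u) \<subseteq> {0, 1})"

definition is_pointed_lgraph :: "nat \<Rightarrow> 'v lgraph \<Rightarrow> 'v \<Rightarrow> bool" where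
  "is_pointed_lgraph d G v \<longleftrightarrow> is_lgraph d G \<and> v \<in> verts G"

definition is_pointed_hom ::
  "('v \<Rightarrow> 'w) \<Rightarrow> 'v lgraph \<Rightarrow> 'v \<Rightarrow> 'w lgraph \<Rightarrow> 'w \<Rightarrow> bool" where
  "is_pointed_hom h G v G' v' \<longleftrightarrow>
     h \<in> verts G \<rightarrow> verts G' \<and> h v = v' \<and>
     (\<forall>u w. {u, w} \<in> edges G \<longrightarrow> {h u, h w} \<in> edges G') \<and>
     (\<forall>u\<in>verts G. \<forall>i<length (label G u). label G u ! i = 1 \<longrightarrow> label G' (h u) ! i = 1)"

text \<open>
  Vectors are lists, because the dimension varies from layer to layer.  The layers
  \<open>1, \<dots>, depth N\<close> are used; \<open>width N l\<close> is the dimension of the features after layer \<open>l\<close>, so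
  \<open>width N 0\<close> is the dimension of the GNN, and \<open>agg_width N l\<close> is the output dimension of
  \<open>agg N l\<close>.

  The entries of all vectors range over a set \<open>scalars N\<close> of real numbers, which is part of
  the GNN.  It cannot be fixed to be all of the reals: the empty multiset lies below
  \<open>{#x#}\<close> for every vector \<open>x\<close>, so a non-decreasing MAX needs a least vector as its value on
  the empty multiset.  The usual choice is the nonnegative reals, with value 0.
\<close>
record gnn =
  depth :: nat
  width :: "nat \<Rightarrow> nat"
  agg_width :: "nat \<Rightarrow> nat"
  scalars :: "real set"
  agg :: "nat \<Rightarrow> real list multiset \<Rightarrow> real list"
  comb :: "nat \<Rightarrow> real list \<Rightarrow> real list"
  cls :: "real list \<Rightarrow> bool"

definition vecs :: "real set \<Rightarrow> nat \<Rightarrow> real list set" where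
  "vecs S n = {x. length x = n \<and> set x \<subseteq> S}"

definition vec_msets :: "real set \<Rightarrow> nat \<Rightarrow> real list multiset set" where
  "vec_msets S n = {M. set_mset M \<subseteq> vecs S n}"

definition agg_dom :: "gnn \<Rightarrow> nat \<Rightarrow> real list multiset set" where
  "agg_dom N l = vec_msets (scalars N) (width N (l - 1))"

definition comb_dom :: "gnn \<Rightarrow> nat \<Rightarrow> real list set" where
  "comb_dom N l = vecs (scalars N) (width N (l - 1) + agg_width N l)"

definition is_gnn :: "gnn \<Rightarrow> bool" where
  "is_gnn N \<longleftrightarrow>
     {0, 1} \<subseteq> scalars N \<and>
     (\<forall>l\<in>{1..depth N}.
        agg N l \<in> agg_dom N l \<rightarrow> vecs (scalars N) (agg_width N l) \<and>
        comb N l \<in> comb_dom N l \<rightarrow> vecs (scalars N) (width N l))"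

definition nbrs :: "'v lgraph \<Rightarrow> 'v \<Rightarrow> 'v set" where
  "nbrs G v = {w. {v, w} \<in> edges G}"

fun feature :: "gnn \<Rightarrow> 'v lgraph \<Rightarrow> nat \<Rightarrow> 'v \<Rightarrow> real list" where
  "feature N G 0 v = label G v"
| "feature N G (Suc l) v =
     comb N (Suc l)
       (feature N G l v @ agg N (Suc l) (image_mset (feature N G l) (mset_set (nbrs G v))))"

definition gnn_out :: "gnn \<Rightarrow> 'v lgraph \<Rightarrow> 'v \<Rightarrow> bool" where
  "gnn_out N G v = cls N (feature N G (depth N) v)"

definition vec_le :: "real list \<Rightarrow> real list \<Rightarrow> bool" where
  "vec_le x y \<longleftrightarrow> list_all2 (\<le>) x y"

text \<open>The occurrences of the elements of a multiset, made distinguishable by an index.\<close>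
definition occs :: "'a multiset \<Rightarrow> ('a \<times> nat) set" where
  "occs M = {(x, i). i < count M x}"

definition mset_le :: "real list multiset \<Rightarrow> real list multiset \<Rightarrow> bool" where
  "mset_le M M' \<longleftrightarrow>
     (\<exists>f. f \<in> occs M \<rightarrow> occs M' \<and> inj_on f (occs M) \<and>
          (\<forall>p\<in>occs M. vec_le (fst p) (fst (f p))))"

definition monotonic :: "gnn \<Rightarrow> bool" where
  "monotonic N \<longleftrightarrow>
     (\<forall>l\<in>{1..depth N}.
        monotone_on (agg_dom N l) mset_le vec_le (agg N l) \<and>
        monotone_on (comb_dom N l) vec_le vec_le (comb N l)) \<and>
     monotone_on (vecs (scalars N) (width N (depth N))) vec_le (\<le>) (cls N)"

text \<open>
  The value on the empty multiset is left open here, since there is no maximum to take.  In a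
  monotonic GNN it is determined: it is the vector all of whose entries are the least element
  of \<open>scalars N\<close>.
\<close>
definition is_MAX :: "gnn \<Rightarrow> nat \<Rightarrow> bool" where
  "is_MAX N l \<longleftrightarrow>
     agg_width N l = width N (l - 1) \<and>
     (\<forall>M\<in>agg_dom N l. M \<noteq> {#} \<longrightarrow>
        (\<forall>i<agg_width N l. agg N l M ! i = Max ((\<lambda>x. x ! i) ` set_mset M)))"

definition monotonic_MAX_gnn :: "gnn \<Rightarrow> bool" where
  "monotonic_MAX_gnn N \<longleftrightarrow>
     is_gnn N \<and> monotonic N \<and> (\<forall>l\<in>{1..depth N}. is_MAX N l)"

end

theory Submission
  imports Defs
begin

text \<open>
  By induction on the layer, the feature of a node \<open>u\<close> lies below that of its image \<open>h u\<close>.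
  A homomorphism may identify neighbours, so it need not give an inequality between the
  multisets of neighbour features; but every feature in the first multiset is dominated by one in
  the second, and for MAX this is enough.  Only for a node without neighbours is the monotonicity
  of the aggregation itself needed, since there the MAX condition is void.
\<close>

lemma vec_le_iff_nth: "vec_le x y \<longleftrightarrow> length x = length y \<and> (\<forall>i<length x. x ! i \<le> y ! i)"
  by (simp add: vec_le_def list_all2_conv_all_nth)

lemma vec_le_append: "vec_le a c \<Longrightarrow> vec_le b d \<Longrightarrow> vec_le (a @ b) (c @ d)"
  by (simp add: vec_le_def list_all2_appendI)

lemma append_in_vecs: "x \<in> vecs S m \<Longrightarrow> y \<in> vecs S n \<Longrightarrow> x @ y \<in> vecs S (m + n)"
  by (auto simp: vecs_def)

lemma mset_le_empty: "mset_le {#} M"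
  by (simp add: mset_le_def occs_def)

text \<open>\<open>mset_set\<close> sends an infinite set to \<open>{#}\<close>, so finiteness is
  what makes the elements of \<open>mset_set (nbrs G u)\<close> exactly the neighbours.\<close>

lemma finite_nbrs:
  assumes "is_lgraph d G"
  shows "finite (nbrs G u)"
proof (rule finite_subset)
  show "nbrs G u \<subseteq> verts G"
    using assms by (fastforce simp: nbrs_def is_lgraph_def doubleton_eq_iff)
  show "finite (verts G)"
    using assms by (simp add: is_lgraph_def)
qed

lemma nbrs_in_verts: "is_lgraph d G \<Longrightarrow> w \<in> nbrs G u \<Longrightarrow> w \<in> verts G"
  by (fastforce simp: nbrs_def is_lgraph_def doubleton_eq_iff)

text \<open>The index shift in \<open>agg_dom\<close> matches: layer \<open>Suc l\<close> aggregates
  vectors of dimension \<open>width N l\<close>.\<close>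

lemma nbr_features_in_agg_dom:
  assumes "is_lgraph d G" and "\<And>w. w \<in> verts G \<Longrightarrow> feature N G l w \<in> vecs (scalars N) (width N l)"
  shows "image_mset (feature N G l) (mset_set (nbrs G u)) \<in> agg_dom N (Suc l)"
  using assms nbrs_in_verts[OF assms(1)] finite_nbrs[OF assms(1)]
  by (auto simp: agg_dom_def vec_msets_def)

text \<open>Monotonicity is assumed only on the domains of the layer functions and of
  \<open>cls\<close>; this places the features in those domains.\<close>

lemma feature_in_vecs:
  assumes "is_gnn N" and "is_lgraph (width N 0) G"
  shows "l \<le> depth N \<Longrightarrow> u \<in> verts G \<Longrightarrow> feature N G l u \<in> vecs (scalars N) (width N l)"
proof (induction l arbitrary: u)
  case 0
  \<comment> \<open>Labels have entries in \<open>{0, 1}\<close>, which \<open>is_gnn\<close>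
    includes in \<open>scalars N\<close>.\<close>
  then show ?case
    using assms by (fastforce simp: is_lgraph_def is_gnn_def vecs_def)
next
  case (Suc l)
  have maps: "agg N (Suc l) \<in> agg_dom N (Suc l) \<rightarrow> vecs (scalars N) (agg_width N (Suc l))"
    "comb N (Suc l) \<in> comb_dom N (Suc l) \<rightarrow> vecs (scalars N) (width N (Suc l))"
    using assms(1) Suc.prems(1) by (auto simp: is_gnn_def)
  have "image_mset (feature N G l) (mset_set (nbrs G u)) \<in> agg_dom N (Suc l)"
    using Suc by (intro nbr_features_in_agg_dom[OF assms(2)]) auto
  then have "feature N G l u @ agg N (Suc l) (image_mset (feature N G l) (mset_set (nbrs G u)))
      \<in> comb_dom N (Suc l)"
    using maps(1) Suc by (auto simp: comb_dom_def intro!: append_in_vecs)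
  then show ?case
    using maps(2) by auto
qed

text \<open>A maximum ignores multiplicities, so several elements of \<open>M\<close> may share one
  dominating element of \<open>M'\<close>; no injection as in \<open>mset_le\<close> is
  required.\<close>

lemma MAX_agg_le:
  assumes N: "monotonic_MAX_gnn N" and l: "l \<in> {1..depth N}"
    and M: "M \<in> agg_dom N l" and M': "M' \<in> agg_dom N l"
    and dominated: "\<And>x. x \<in># M \<Longrightarrow> \<exists>y. y \<in># M' \<and> vec_le x y"
  shows "vec_le (agg N l M) (agg N l M')"
proof (cases "M = {#}")
  case True
  moreover have "monotone_on (agg_dom N l) mset_le vec_le (agg N l)"
    using N l by (auto simp: monotonic_MAX_gnn_def monotonic_def)
  ultimately show ?thesis
    using M M' mset_le_empty by (auto dest: monotone_onD)
next
  case False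
  \<comment> \<open>Some element of \<open>M\<close> exists and has a dominating element in
    \<open>M'\<close>; hence the MAX equation applies to both multisets.\<close>
  then have "M' \<noteq> {#}"
    using dominated by fastforce
  have MAX: "is_MAX N l"
    using N l by (auto simp: monotonic_MAX_gnn_def)
  have "agg N l \<in> agg_dom N l \<rightarrow> vecs (scalars N) (agg_width N l)"
    using N l by (auto simp: monotonic_MAX_gnn_def is_gnn_def)
  then have len: "length (agg N l M) = agg_width N l" "length (agg N l M') = agg_width N l"
    using M M' by (auto simp: vecs_def)
  have "agg N l M ! i \<le> agg N l M' ! i" if i: "i < agg_width N l" for i
  proof -
    have "x ! i \<le> Max ((\<lambda>y. y ! i) ` set_mset M')" if x: "x \<in># M" for x
    proof -
      obtain y where y: "y \<in># M'" "vec_le x y"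
        using dominated x by blast
      \<comment> \<open>\<open>x\<close> has length \<open>width N (l - 1)\<close>, which
        \<open>is_MAX\<close> equates with \<open>agg_width N l\<close>; so \<open>i\<close> is a
        valid index into \<open>x\<close>.\<close>
      have "length x = agg_width N l"
        using x M MAX by (auto simp: is_MAX_def agg_dom_def vec_msets_def vecs_def)
      then have "x ! i \<le> y ! i"
        using y(2) i by (simp add: vec_le_iff_nth)
      also have "\<dots> \<le> Max ((\<lambda>y. y ! i) ` set_mset M')"
        using y(1) by simp
      finally show ?thesis .
    qed
    then have "Max ((\<lambda>x. x ! i) ` set_mset M) \<le> Max ((\<lambda>x. x ! i) ` set_mset M')"
      using False by simp
    then show ?thesis
      using MAX M M' False \<open>M' \<noteq> {#}\<close> i by (simp add: is_MAX_def)
  qed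
  then show ?thesis
    by (simp add: vec_le_iff_nth len)
qed

text \<open>For 0/1 vectors, preserving the entries equal to 1 amounts to the componentwise
  order.\<close>

lemma label_le_hom:
  assumes "is_lgraph d G" and "is_lgraph d G'" and "is_pointed_hom h G v G' v'" and "u \<in> verts G"
  shows "vec_le (label G u) (label G' (h u))"
proof -
  have hu: "h u \<in> verts G'"
    using assms by (auto simp: is_pointed_hom_def)
  have len: "length (label G u) = d" "length (label G' (h u)) = d"
    and bits: "set (label G u) \<subseteq> {0, 1}" "set (label G' (h u)) \<subseteq> {0, 1}"
    using assms hu by (auto simp: is_lgraph_def)
  have "label G u ! i \<le> label G' (h u) ! i" if i: "i < d" for i
  proof -
    have "label G u ! i \<in> {0, 1}" "label G' (h u) ! i \<in> {0, 1}"
      using bits len i by (metis nth_mem subsetD)+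
    moreover have "label G u ! i = 1 \<longrightarrow> label G' (h u) ! i = 1"
      using assms i len by (auto simp: is_pointed_hom_def)
    ultimately show ?thesis
      by auto
  qed
  then show ?thesis
    by (simp add: vec_le_iff_nth len)
qed

text \<open>The node \<open>u\<close> varies in the induction, since the step needs the inequality
  at \<open>u\<close> and at all of its neighbours.\<close>

lemma feature_le_hom:
  assumes N: "monotonic_MAX_gnn N"
    and G: "is_lgraph (width N 0) G" and G': "is_lgraph (width N 0) G'"
    and h: "is_pointed_hom h G v G' v'"
  shows "l \<le> depth N \<Longrightarrow> u \<in> verts G \<Longrightarrow> vec_le (feature N G l u) (feature N G' l (h u))"
proof (induction l arbitrary: u)
  case 0
  then show ?case
    using label_le_hom[OF G G' h] by simp
next
  case (Suc l)
  let ?M = "image_mset (feature N G l) (mset_set (nbrs G u))"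
  let ?M' = "image_mset (feature N G' l) (mset_set (nbrs G' (h u)))"
  have l: "Suc l \<in> {1..depth N}"
    using Suc.prems by simp
  have gnn: "is_gnn N"
    using N by (simp add: monotonic_MAX_gnn_def)
  have hu: "h u \<in> verts G'"
    using h Suc.prems by (auto simp: is_pointed_hom_def)
  have M: "?M \<in> agg_dom N (Suc l)"
    using Suc.prems by (intro nbr_features_in_agg_dom[OF G] feature_in_vecs[OF gnn G]) auto
  have M': "?M' \<in> agg_dom N (Suc l)"
    using Suc.prems by (intro nbr_features_in_agg_dom[OF G'] feature_in_vecs[OF gnn G']) auto
  have agg_le: "vec_le (agg N (Suc l) ?M) (agg N (Suc l) ?M')"
  proof (rule MAX_agg_le[OF N l M M'])
    fix x
    assume "x \<in># ?M"
    then obtain w where w: "w \<in> nbrs G u" "x = feature N G l w"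
      using finite_nbrs[OF G] by auto
    \<comment> \<open>The edge \<open>{u, w}\<close> is mapped to \<open>{h u, h w}\<close>, so the
      feature of \<open>h w\<close> is the dominating witness for that of \<open>w\<close>.\<close>
    then have "h w \<in> nbrs G' (h u)"
      using h by (simp add: nbrs_def is_pointed_hom_def)
    moreover have "vec_le x (feature N G' l (h w))"
      using Suc w nbrs_in_verts[OF G] by auto
    ultimately show "\<exists>y. y \<in># ?M' \<and> vec_le x y"
      using finite_nbrs[OF G'] by auto
  qed
  have agg_in: "agg N (Suc l) \<in> agg_dom N (Suc l) \<rightarrow> vecs (scalars N) (agg_width N (Suc l))"
    using gnn l by (auto simp: is_gnn_def)
  have "feature N G l u @ agg N (Suc l) ?M \<in> comb_dom N (Suc l)"
    using agg_in M Suc.prems feature_in_vecs[OF gnn G]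
    by (auto simp: comb_dom_def intro!: append_in_vecs)
  moreover have "feature N G' l (h u) @ agg N (Suc l) ?M' \<in> comb_dom N (Suc l)"
    using agg_in M' Suc.prems hu feature_in_vecs[OF gnn G']
    by (auto simp: comb_dom_def intro!: append_in_vecs)
  moreover have "vec_le (feature N G l u @ agg N (Suc l) ?M)
      (feature N G' l (h u) @ agg N (Suc l) ?M')"
    using agg_le Suc by (intro vec_le_append) auto
  moreover have "monotone_on (comb_dom N (Suc l)) vec_le vec_le (comb N (Suc l))"
    using N l by (auto simp: monotonic_MAX_gnn_def monotonic_def)
  ultimately show ?case
    by (auto dest: monotone_onD)
qed

theorem theorem5p4:
  fixes N :: gnn and G :: "'v lgraph" and v :: 'v and G' :: "'w lgraph" and v' :: 'w
  assumes "monotonic_MAX_gnn N"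
    and "is_pointed_lgraph (width N 0) G v"
    and "is_pointed_lgraph (width N 0) G' v'"
    and "\<exists>h. is_pointed_hom h G v G' v'"
    and "gnn_out N G v = True"
  shows "gnn_out N G' v' = True"
proof -
  obtain h where h: "is_pointed_hom h G v G' v'"
    using assms(4) by blast
  have hv: "h v = v'"
    using h by (simp add: is_pointed_hom_def)
  have G: "is_lgraph (width N 0) G" "v \<in> verts G"
    and G': "is_lgraph (width N 0) G'" "v' \<in> verts G'"
    using assms(2,3) by (auto simp: is_pointed_lgraph_def)
  have gnn: "is_gnn N"
    and cls: "monotone_on (vecs (scalars N) (width N (depth N))) vec_le (\<le>) (cls N)"
    using assms(1) by (auto simp: monotonic_MAX_gnn_def monotonic_def)
  have "vec_le (feature N G (depth N) v) (feature N G' (depth N) v')"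
    using feature_le_hom[OF assms(1) G(1) G'(1) h order_refl G(2)] hv by simp
  \<comment> \<open>On truth values \<open>\<le>\<close> is implication, so acceptance passes from
    \<open>v\<close> to \<open>v'\<close>.\<close>
  then have "cls N (feature N G (depth N) v) \<le> cls N (feature N G' (depth N) v')"
    using monotone_onD[OF cls] feature_in_vecs[OF gnn G(1) order_refl G(2)]
      feature_in_vecs[OF gnn G'(1) order_refl G'(2)] by blast
  then show ?thesis
    using assms(5) by (simp add: gnn_out_def)
qed

end
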